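(* Let $C$ be a nonempty closed convex subset of a real Hilbert space $H$ and $T$ a nonexpansive mapping of $C$ into itself such that $F(T)\ne\emptyset$. Assume that $\{\alpha_n\}_{n\ge0}$ and $\{\beta_n\}_{n\ge0}$ are sequences in $[0,1]$ and $\alpha,\beta$ are constants such that, for all $n$, $0\le\alpha_n\le\alpha<1$ and $$0\le\frac{\alpha_n}{1-\alpha_n}\le\frac{\alpha}{1-\alpha}<\beta\le\beta_n\le1.$$ Let $x_0\in C$ be arbitrary and define $\{x_n\}$ in $C$, for $n\ge0$, by $$v_n=(1-\alpha_n)x_n+\alpha_nTx_n,\qquad y_n=(1-\beta_n)x_n+\beta_nTv_n,$$ $$C_n=\{z\in C:\|z-y_n\|^2\le\|z-x_n\|^2+\beta_n(\|v_n\|^2-\|x_n\|^2+2\langle x_n-v_n,z\rangle)\},$$ $$Q_n=\{z\in C:\langle z-x_n,x_n-x_0\rangle\ge0\},$$ $$x_{n+1}=P_{C_n^*\cap Q_n}x_0,$$ where $C_n^*$ is a closed convex set with $F(T)\subset C_n^*\subset C_n$. Then $\{x_n\}$ converges strongly to $P_{F(T)}x_0$.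
   Context: $F(T)=\{x\in C:Tx=x\}$. $T$ is nonexpansive if $\|Tx-Ty\|\le\|x-y\|$ for all $x,y\in C$. For a nonempty closed convex set $D\subset H$, $P_D$ is the metric projection (nearest-point map) onto $D$. *)

theory Defs
  imports "HOL-Analysis.Analysis"
begin

text \<open>
  A real Hilbert space is a type of sort \<open>{real_inner, complete_space}\<close>. A self-map of a subset
  \<open>C\<close> is a total function with \<open>T ` C \<subseteq> C\<close>; its values outside \<open>C\<close> are irrelevant, so
  all notions below are relativised to \<open>C\<close>.
\<close>

definition fixed_point_set :: "'a set \<Rightarrow> ('a \<Rightarrow> 'a) \<Rightarrow> 'a set" where
  "fixed_point_set C T = {x \<in> C. T x = x}"

definition nonexpansive_on :: "'a::real_normed_vector set \<Rightarrow> ('a \<Rightarrow> 'a) \<Rightarrow> bool" where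
  "nonexpansive_on C T \<longleftrightarrow> (\<forall>x\<in>C. \<forall>y\<in>C. norm (T x - T y) \<le> norm (x - y))"

text \<open>
  The library's \<^const>\<open>closest_point\<close> is confined to the sort \<open>heine_borel\<close>, that is, to finite
  dimension. The nearest point below exists and is unique whenever \<open>D\<close> is a nonempty closed
  convex subset of a Hilbert space; for other \<open>D\<close> the value may be unspecified.
\<close>

definition metric_projection :: "'a::real_inner set \<Rightarrow> 'a \<Rightarrow> 'a" where
  "metric_projection D x = (THE p. p \<in> D \<and> (\<forall>z\<in>D. norm (x - p) \<le> norm (x - z)))"

end

theory Submission
  imports Defs
begin

text \<open>
  Write \<open>F\<close> for the fixed-point set. The set \<open>Q n\<close> is the part of \<open>C\<close> in a half-space on which \<open>x n\<close> is nearest to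
  \<open>x0\<close>. By induction \<open>F \<subseteq> Q n\<close>: if \<open>F\<close> lies in \<open>Cstar n \<inter> Q n\<close>, then the obtuse-angle property of the
  projection \<open>x (Suc n)\<close> onto that set says that \<open>F \<subseteq> Q (Suc n)\<close>. Two consequences of the obtuse angle
  follow. First, every \<open>x n\<close> is at distance at most \<open>norm (q - x0)\<close> from \<open>x0\<close> and from \<open>q\<close>, for each \<open>q \<in> F\<close>.
  Second, since \<open>x (Suc n) \<in> Q n\<close>, Pythagoras makes \<open>(norm (x n - x0))\<^sup>2\<close> grow by at least
  \<open>(norm (x (Suc n) - x n))\<^sup>2\<close> in each step, so the steps tend to \<open>0\<close> (\<open>steps_vanish\<close>).

  Membership of \<open>x (Suc n)\<close> in the cut \<open>Cn n\<close> turns small steps into small residuals. Up to a multiple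
  of the step length, it gives \<open>b n * (norm (x n - T (v n)))\<^sup>2 \<le> (norm (x n - v n))\<^sup>2\<close>
  (\<open>cut_residual_bound\<close>). As \<open>norm (x n - v n) = a n * N\<close> and
  \<open>norm (x n - T (v n)) \<ge> (1 - a n) * N\<close> with \<open>N = norm (x n - T (x n))\<close>, and as \<open>b n\<close> exceeds
  \<open>(\<alpha> / (1 - \<alpha>))\<^sup>2\<close> by a fixed amount, \<open>N\<close> must tend to \<open>0\<close> (\<open>residual_absorption\<close>).

  It remains to see that approximate fixed points \<open>x n\<close> with \<open>F \<subseteq> Q n\<close> for all \<open>n\<close> converge to the
  projection of \<open>x0\<close> onto \<open>F\<close>. The usual argument extracts weak cluster points and applies
  demiclosedness of \<open>I - T\<close>. The proof below stays with norm convergence. Let \<open>z k\<close> solve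
  \<open>z - T z = s k *\<^sub>R (x0 - z)\<close> with \<open>s k\<close> decreasing to \<open>0\<close>. Monotonicity of \<open>I - T\<close> shows that the
  \<open>z k\<close> converge in norm to some \<open>p \<in> F\<close> (\<open>resolvent_converges\<close>); the same monotonicity, applied to
  \<open>x n\<close> and \<open>z k\<close>, gives \<open>s k * inner (x0 - z k) (x n - z k) \<le> inner (x n - T (x n)) (x n - z k)\<close>,
  whose right side vanishes as \<open>n\<close> grows. Letting \<open>k\<close> grow afterwards, the upper limit of
  \<open>inner (x0 - p) (x n - p)\<close> is at most \<open>0\<close>. Since \<open>p \<in> Q n\<close> means exactly
  \<open>(norm (x n - p))\<^sup>2 \<le> inner (x0 - p) (x n - p)\<close>, the sequence converges to \<open>p\<close>, and \<open>p\<close> inherits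
  the obtuse-angle property with respect to \<open>F\<close>, so it is the projection.
\<close>

section \<open>Nearest points in a Hilbert space\<close>

text \<open>
  The Cauchy criterion in the form that Hilbert space identities deliver: parallelogram and
  Pythagoras bound squared distances by the errors of two real sequences.
\<close>

lemma Cauchy_of_sq_dist_le:
  fixes u :: "nat \<Rightarrow> 'a::real_normed_vector"
  assumes e: "e \<longlonglongrightarrow> 0" and le: "\<And>m n. (norm (u m - u n))\<^sup>2 \<le> e m + e n"
  shows "Cauchy u"
proof (rule metric_CauchyI)
  fix r :: real assume "0 < r"
  then have "eventually (\<lambda>n. e n < r\<^sup>2 / 2) sequentially"
    using e by (intro order_tendstoD(2)[of _ 0]) auto
  then obtain N where N: "\<And>n. n \<ge> N \<Longrightarrow> e n < r\<^sup>2 / 2"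
    by (auto simp: eventually_sequentially)
  show "\<exists>M. \<forall>m\<ge>M. \<forall>n\<ge>M. dist (u m) (u n) < r"
  proof (intro exI allI impI)
    fix m n assume "N \<le> m" "N \<le> n"
    then have "(norm (u m - u n))\<^sup>2 < r\<^sup>2"
      using le[of m n] N[of m] N[of n] by simp
    then show "dist (u m) (u n) < r"
      using \<open>0 < r\<close> by (auto simp: dist_norm intro: power2_less_imp_less)
  qed
qed

text \<open>
  A sequence in \<open>D\<close> that minimises the distance to \<open>x\<close> is Cauchy: midpoints stay in \<open>D\<close>, so by the
  parallelogram identity two almost nearest points are close to each other.
\<close>

lemma nearest_point_exists:
  fixes D :: "'a::{real_inner, complete_space} set"
  assumes "closed D" "convex D" "D \<noteq> {}"
  shows "\<exists>p\<in>D. \<forall>z\<in>D. norm (x - p) \<le> norm (x - z)"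
proof -
  define d where "d = infdist x D"
  have d_le: "d \<le> norm (x - z)" if "z \<in> D" for z
    using infdist_le[OF that, of x] by (simp add: d_def dist_norm)
  have d0: "0 \<le> d"
    by (simp add: d_def infdist_nonneg)
  define c where "c = (\<lambda>n. d + inverse (real (Suc n)))"
  have "\<exists>z\<in>D. norm (x - z) < c n" for n
  proof -
    have "(INF a\<in>D. dist x a) < c n"
      using assms(3) by (simp add: c_def d_def infdist_notempty)
    then show ?thesis
      using assms(3) by (subst (asm) cINF_less_iff) (auto simp: dist_norm intro: bdd_belowI2[where m = 0])
  qed
  then obtain u where uD: "\<And>n. u n \<in> D" and u: "\<And>n. norm (x - u n) < c n"
    by metis
  have c_lim: "c \<longlonglongrightarrow> d"
    unfolding c_def using tendsto_add[OF tendsto_const LIMSEQ_inverse_real_of_nat] by simp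
  define e where "e = (\<lambda>n. 2 * ((c n)\<^sup>2 - d\<^sup>2))"
  have "e \<longlonglongrightarrow> 2 * (d\<^sup>2 - d\<^sup>2)"
    unfolding e_def by (intro tendsto_intros c_lim)
  then have e: "e \<longlonglongrightarrow> 0"
    by simp
  have "(norm (u m - u n))\<^sup>2 \<le> e m + e n" for m n
  proof -
    have "(1/2) *\<^sub>R u m + (1/2) *\<^sub>R u n \<in> D"
      using assms(2) uD by (intro convexD) auto
    from d_le[OF this] d0
    have mid: "d\<^sup>2 \<le> (norm (x - ((1/2) *\<^sub>R u m + (1/2) *\<^sub>R u n)))\<^sup>2"
      by (intro power_mono)
    have par: "(norm (u m - u n))\<^sup>2 = 2 * (norm (x - u m))\<^sup>2 + 2 * (norm (x - u n))\<^sup>2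
        - 4 * (norm (x - ((1/2) *\<^sub>R u m + (1/2) *\<^sub>R u n)))\<^sup>2"
      by (simp add: power2_norm_eq_inner inner_simps inner_commute algebra_simps)
    have "(norm (x - u m))\<^sup>2 \<le> (c m)\<^sup>2" "(norm (x - u n))\<^sup>2 \<le> (c n)\<^sup>2"
      using u by (simp_all add: less_imp_le power_mono)
    then show ?thesis
      using mid par by (simp add: e_def)
  qed
  from Cauchy_of_sq_dist_le[OF e this] obtain p where p: "u \<longlonglongrightarrow> p"
    using Cauchy_convergent convergent_def by blast
  have "p \<in> D"
    using closed_sequentially[OF assms(1)] uD p by blast
  moreover have "norm (x - p) \<le> d"
    by (rule LIMSEQ_le[OF tendsto_norm[OF tendsto_diff[OF tendsto_const p]] c_lim])
       (use u in \<open>auto intro: less_imp_le\<close>)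
  ultimately show ?thesis
    using d_le by force
qed

lemma metric_projection_eqI:
  assumes "p \<in> D" "\<And>z. z \<in> D \<Longrightarrow> norm (x - p) \<le> norm (x - z)"
    and "\<And>q. q \<in> D \<Longrightarrow> norm (x - q) \<le> norm (x - p) \<Longrightarrow> q = p"
  shows "metric_projection D x = p"
  unfolding metric_projection_def by (rule the_equality) (use assms in blast)+

lemma
  fixes D :: "'a::{real_inner, complete_space} set"
  assumes "closed D" "convex D" "D \<noteq> {}"
  shows metric_projection_in: "metric_projection D x \<in> D"
    and metric_projection_obtuse:
      "z \<in> D \<Longrightarrow> 0 \<le> inner (z - metric_projection D x) (metric_projection D x - x)"
proof -
  obtain p where p: "p \<in> D" "\<And>z. z \<in> D \<Longrightarrow> norm (x - p) \<le> norm (x - z)"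
    using nearest_point_exists[OF assms] by blast
  have "metric_projection D x = p"
  proof (rule metric_projection_eqI[OF p])
    fix q assume q: "q \<in> D" "norm (x - q) \<le> norm (x - p)"
    with p show "q = p"
      using any_closest_point_unique[OF assms(2,1), of q p x] by (force simp: dist_norm)
  qed
  with p show "metric_projection D x \<in> D"
    and "z \<in> D \<Longrightarrow> 0 \<le> inner (z - metric_projection D x) (metric_projection D x - x)"
    using any_closest_point_dot[OF assms(2,1) p(1), of z x]
    by (auto simp: dist_norm inner_simps inner_commute algebra_simps)
qed

text \<open>
  Pythagoras for an obtuse angle at \<open>p\<close>. With \<open>x = x0\<close> and \<open>p = x n\<close> the premise is membership of
  \<open>z\<close> in \<open>Q n\<close>.
\<close>

lemma obtuse_imp_sum_sq_le:
  fixes p z x :: "'a::real_inner"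
  assumes "0 \<le> inner (z - p) (p - x)"
  shows "(norm (z - p))\<^sup>2 + (norm (p - x))\<^sup>2 \<le> (norm (z - x))\<^sup>2"
proof -
  have "(norm (z - x))\<^sup>2 = (norm (z - p))\<^sup>2 + (norm (p - x))\<^sup>2 + 2 * inner (z - p) (p - x)"
    by (simp add: power2_norm_eq_inner inner_simps inner_commute algebra_simps)
  with assms show ?thesis
    by simp
qed

lemma
  fixes p z x :: "'a::real_inner"
  assumes "0 \<le> inner (z - p) (p - x)"
  shows obtuse_imp_norm_le_left: "norm (z - p) \<le> norm (z - x)"
    and obtuse_imp_norm_le_right: "norm (p - x) \<le> norm (z - x)"
proof -
  note sq = obtuse_imp_sum_sq_le[OF assms]
  show "norm (z - p) \<le> norm (z - x)"
    by (rule power2_le_imp_le) (use sq zero_le_power2[of "norm (p - x)"] in linarith, simp)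
  show "norm (p - x) \<le> norm (z - x)"
    by (rule power2_le_imp_le) (use sq zero_le_power2[of "norm (z - p)"] in linarith, simp)
qed

section \<open>Approximate fixed points of a nonexpansive map\<close>

lemma nonexpansive_on_monotone:
  fixes T :: "'a::real_inner \<Rightarrow> 'a"
  assumes "nonexpansive_on C T" "x \<in> C" "y \<in> C"
  shows "0 \<le> inner ((x - T x) - (y - T y)) (x - y)"
proof -
  have "inner (T x - T y) (x - y) \<le> norm (T x - T y) * norm (x - y)"
    by (rule norm_cauchy_schwarz)
  also have "\<dots> \<le> norm (x - y) * norm (x - y)"
    using assms by (intro mult_right_mono) (auto simp: nonexpansive_on_def)
  also have "\<dots> = inner (x - y) (x - y)"
    by (simp add: power2_norm_eq_inner power2_eq_square[symmetric])
  finally show ?thesis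
    by (simp add: inner_simps algebra_simps)
qed

text \<open>
  The equation is the fixed-point equation of \<open>z \<mapsto> (T z + s *\<^sub>R x0) / (1 + s)\<close>, a contraction with
  constant \<open>1 / (1 + s)\<close> that maps \<open>C\<close> into itself by convexity.
\<close>

lemma resolvent_exists:
  fixes T :: "'a::{real_inner, complete_space} \<Rightarrow> 'a"
  assumes "closed C" "convex C" "T ` C \<subseteq> C" "nonexpansive_on C T" "x0 \<in> C" "0 < s"
  shows "\<exists>z\<in>C. z - T z = s *\<^sub>R (x0 - z)"
proof -
  define S where "S = (\<lambda>z. (1 / (1 + s)) *\<^sub>R T z + (s / (1 + s)) *\<^sub>R x0)"
  have "\<exists>!z\<in>C. S z = z"
  proof (rule Banach_fix)
    show "complete C" "C \<noteq> {}" "0 \<le> 1 / (1 + s)" "1 / (1 + s) < 1"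
      using assms by (auto simp: complete_eq_closed)
    show "S ` C \<subseteq> C"
      unfolding S_def using assms
      by (auto intro!: convexD simp: add_divide_distrib[symmetric])
    show "dist (S x) (S y) \<le> 1 / (1 + s) * dist x y" if "x \<in> C" "y \<in> C" for x y
    proof -
      have "S x - S y = (1 / (1 + s)) *\<^sub>R (T x - T y)"
        by (simp add: S_def algebra_simps)
      then show ?thesis
        using assms that by (simp add: dist_norm nonexpansive_on_def divide_right_mono)
    qed
  qed
  then obtain z where z: "z \<in> C" "S z = z"
    by blast
  have "(1 + s) *\<^sub>R z = (1 + s) *\<^sub>R S z"
    using z by simp
  also have "\<dots> = T z + s *\<^sub>R x0"
    using assms(6) by (simp add: S_def scaleR_add_right)
  finally show ?thesis
    using z(1) by (intro bexI[of _ z]) (simp_all add: algebra_simps)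
qed

text \<open>
  Monotonicity of \<open>I - T\<close> forces an obtuse angle at the resolvent point \<open>z\<close> with the larger parameter.
  The case \<open>r = 0\<close> covers a fixed point \<open>w\<close> and so bounds all resolvent points.
\<close>

lemma resolvent_sq_le:
  fixes T :: "'a::real_inner \<Rightarrow> 'a"
  assumes "nonexpansive_on C T" "w \<in> C" "z \<in> C"
    and "w - T w = r *\<^sub>R (x0 - w)" "z - T z = s *\<^sub>R (x0 - z)" "0 \<le> r" "r < s"
  shows "(norm (w - z))\<^sup>2 + (norm (z - x0))\<^sup>2 \<le> (norm (w - x0))\<^sup>2"
proof (rule obtuse_imp_sum_sq_le)
  have "0 \<le> inner (s *\<^sub>R (x0 - z) - r *\<^sub>R (x0 - w)) (z - w)"
    using nonexpansive_on_monotone[OF assms(1,3,2)] assms(4,5) by simp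
  also have "\<dots> = (s - r) * inner (w - z) (z - x0) - r * inner (z - w) (z - w)"
    by (simp add: inner_simps inner_commute algebra_simps)
  finally have "0 \<le> (s - r) * inner (w - z) (z - x0)"
    using mult_nonneg_nonneg[OF assms(6) inner_ge_zero[of "z - w"]] by linarith
  then show "0 \<le> inner (w - z) (z - x0)"
    using assms(7) by (simp add: zero_le_mult_iff)
qed

text \<open>
  The squared distances of \<open>z k\<close> to \<open>x0\<close> increase and are bounded by the distance of any fixed point;
  their increments dominate the squared mutual distances of the points.
\<close>

lemma resolvent_converges:
  fixes T :: "'a::{real_inner, complete_space} \<Rightarrow> 'a"
  assumes "closed C" "nonexpansive_on C T" "fixed_point_set C T \<noteq> {}"
    and zC: "\<And>k. z k \<in> C"
    and z: "\<And>k. z k - T (z k) = s k *\<^sub>R (x0 - z k)"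
    and s_pos: "\<And>k. 0 < s k" and s_dec: "\<And>j k. j < k \<Longrightarrow> s k < s j" and s_lim: "s \<longlonglongrightarrow> 0"
  shows "\<exists>p\<in>fixed_point_set C T. z \<longlonglongrightarrow> p"
proof -
  define r where "r = (\<lambda>k. (norm (z k - x0))\<^sup>2)"
  have step: "(norm (z k - z j))\<^sup>2 + r j \<le> r k" if "j < k" for j k
    unfolding r_def
    using resolvent_sq_le[OF assms(2) zC zC z z less_imp_le[OF s_pos] s_dec[OF that]] .
  obtain q where q: "q \<in> C" "T q = q"
    using assms(3) by (auto simp: fixed_point_set_def)
  have bound: "r k \<le> (norm (q - x0))\<^sup>2" for k
  proof -
    have "(norm (q - z k))\<^sup>2 + (norm (z k - x0))\<^sup>2 \<le> (norm (q - x0))\<^sup>2"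
      using resolvent_sq_le[OF assms(2) q(1) zC _ z order_refl s_pos] q(2) by simp
    then show ?thesis
      using zero_le_power2[of "norm (q - z k)"] unfolding r_def by linarith
  qed
  have "incseq r"
  proof (rule incseq_SucI)
    show "r k \<le> r (Suc k)" for k
      using step[of k "Suc k"] zero_le_power2[of "norm (z (Suc k) - z k)"] by linarith
  qed
  then obtain L where L: "r \<longlonglongrightarrow> L"
    using incseq_convergent bound by blast
  define e where "e = (\<lambda>k. \<bar>r k - L\<bar>)"
  have e: "e \<longlonglongrightarrow> 0"
    unfolding e_def using L by (simp add: LIM_zero_iff tendsto_rabs_zero_iff)
  have "(norm (z j - z k))\<^sup>2 \<le> e j + e k" for j k
  proof (cases j k rule: linorder_cases)
    case less
    then show ?thesis using step[OF less] by (simp add: e_def norm_minus_commute)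
  next
    case equal
    then show ?thesis by (simp add: e_def)
  next
    case greater
    then show ?thesis using step[OF greater] by (simp add: e_def)
  qed
  from Cauchy_of_sq_dist_le[OF e this] obtain p where p: "z \<longlonglongrightarrow> p"
    using Cauchy_convergent convergent_def by blast
  have pC: "p \<in> C"
    using closed_sequentially[OF assms(1)] zC p by blast
  have "(\<lambda>k. T (z k)) \<longlonglongrightarrow> T p"
  proof (rule Lim_transform_bound[THEN Lim_null[THEN iffD2]])
    show "\<forall>\<^sub>F k in sequentially. norm (T (z k) - T p) \<le> norm (z k - p)"
      using assms(2) zC pC by (auto simp: nonexpansive_on_def)
    show "((\<lambda>k. z k - p) \<longlongrightarrow> 0) sequentially"
      using p by (simp add: LIM_zero_iff)
  qed
  then have "(\<lambda>k. z k - T (z k)) \<longlonglongrightarrow> p - T p"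
    by (intro tendsto_intros p)
  moreover have "(\<lambda>k. z k - T (z k)) \<longlonglongrightarrow> 0 *\<^sub>R (x0 - p)"
    unfolding z by (intro tendsto_intros p s_lim)
  ultimately have "p - T p = 0 *\<^sub>R (x0 - p)"
    by (rule LIMSEQ_unique)
  with pC p show ?thesis
    by (auto simp: fixed_point_set_def)
qed

text \<open>
  Replaces weak compactness and demiclosedness: no approximate fixed-point sequence can, in the limit,
  lie on the side of \<open>p\<close> towards \<open>x0\<close>. The point \<open>p\<close> is the norm limit of the resolvent points, and
  it does not depend on the sequence.
\<close>

lemma approximate_fixed_points_asymptotic_obtuse:
  fixes T :: "'a::{real_inner, complete_space} \<Rightarrow> 'a"
  assumes C: "closed C" "convex C" "T ` C \<subseteq> C" "nonexpansive_on C T"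
    and F: "fixed_point_set C T \<noteq> {}" and x0: "x0 \<in> C"
  shows "\<exists>p\<in>fixed_point_set C T. \<forall>x. (\<forall>n. x n \<in> C) \<longrightarrow> Bseq x \<longrightarrow> (\<lambda>n. x n - T (x n)) \<longlonglongrightarrow> 0 \<longrightarrow>
    (\<forall>e>0. \<forall>\<^sub>F n in sequentially. inner (x0 - p) (x n - p) < e)"
proof -
  define s where "s = (\<lambda>k. inverse (real (Suc k)))"
  have s_pos: "0 < s k" for k
    by (simp add: s_def)
  have s_dec: "s k < s j" if "j < k" for j k
    using that by (simp add: s_def)
  have s_lim: "s \<longlonglongrightarrow> 0"
    unfolding s_def by (rule LIMSEQ_inverse_real_of_nat)
  have "\<exists>z\<in>C. z - T z = s k *\<^sub>R (x0 - z)" for k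
    using resolvent_exists[OF C x0 s_pos] .
  then obtain z where zC: "\<And>k. z k \<in> C" and z: "\<And>k. z k - T (z k) = s k *\<^sub>R (x0 - z k)"
    by metis
  obtain p where p: "p \<in> fixed_point_set C T" and lim: "z \<longlonglongrightarrow> p"
    using resolvent_converges[OF C(1,4) F zC z s_pos s_dec s_lim] by blast
  show ?thesis
  proof (intro bexI[OF _ p] allI impI)
    fix x :: "nat \<Rightarrow> 'a" and e :: real
    assume xC: "\<forall>n. x n \<in> C" and "Bseq x" and res: "(\<lambda>n. x n - T (x n)) \<longlonglongrightarrow> 0" and "0 < e"
    then obtain B where B: "\<And>n. norm (x n) \<le> B"
      by (auto simp: Bseq_def)
    \<comment> \<open>\<open>g k\<close> is the cost of exchanging \<open>p\<close> for the resolvent point \<open>z k\<close> in the inner product. With \<open>k\<close>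
      fixed, \<open>h n\<close> bounds the exchanged inner product through monotonicity.\<close>
    define g where "g = (\<lambda>k. norm (z k - p) * (B + norm p) + norm (x0 - z k) * norm (z k - p))"
    have "g \<longlonglongrightarrow> norm (p - p) * (B + norm p) + norm (x0 - p) * norm (p - p)"
      unfolding g_def by (intro tendsto_intros lim)
    then have "\<forall>\<^sub>F k in sequentially. g k < e / 2"
      using \<open>0 < e\<close> by (intro order_tendstoD(2)[of _ 0]) auto
    then obtain k where k: "g k < e / 2"
      using eventually_happens' sequentially_bot by blast
    define h where "h = (\<lambda>n. norm (x n - T (x n)) * (B + norm (z k)) / s k)"
    have "h \<longlonglongrightarrow> norm (0::'a) * (B + norm (z k)) / s k"
      unfolding h_def by (intro tendsto_intros res) (use s_pos[of k] in simp)
    then have "\<forall>\<^sub>F n in sequentially. h n < e / 2"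
      using \<open>0 < e\<close> by (intro order_tendstoD(2)[of _ 0]) auto
    then show "\<forall>\<^sub>F n in sequentially. inner (x0 - p) (x n - p) < e"
    proof eventually_elim
      case (elim n)
      have "s k * inner (x0 - z k) (x n - z k) \<le> inner (x n - T (x n)) (x n - z k)"
        using nonexpansive_on_monotone[OF C(4) xC[rule_format] zC, of n k]
        unfolding z by (simp add: inner_diff_left)
      also have "\<dots> \<le> norm (x n - T (x n)) * norm (x n - z k)"
        by (rule norm_cauchy_schwarz)
      also have "\<dots> \<le> norm (x n - T (x n)) * (B + norm (z k))"
        using B[of n] norm_triangle_ineq4[of "x n" "z k"] by (intro mult_left_mono) auto
      finally have 1: "inner (x0 - z k) (x n - z k) \<le> h n"
        using s_pos[of k] by (simp add: h_def field_simps)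
      have "inner (z k - p) (x n - p) \<le> norm (z k - p) * norm (x n - p)"
        by (rule norm_cauchy_schwarz)
      also have "\<dots> \<le> norm (z k - p) * (B + norm p)"
        using B[of n] norm_triangle_ineq4[of "x n" p] by (intro mult_left_mono) auto
      finally have 2: "inner (z k - p) (x n - p) \<le> norm (z k - p) * (B + norm p)" .
      have "inner (x0 - p) (x n - p) = inner (x0 - z k) (x n - z k)
          + inner (z k - p) (x n - p) + inner (x0 - z k) (z k - p)"
        by (simp add: inner_simps inner_commute)
      also have "\<dots> \<le> h n + g k"
        using 1 2 norm_cauchy_schwarz[of "x0 - z k" "z k - p"] by (simp add: g_def)
      finally show ?case
        using elim k by simp
    qed
  qed
qed

text \<open>
  The last hypothesis gives boundedness, and at \<open>q = p\<close> it reads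
  \<open>(norm (x n - p))\<^sup>2 \<le> inner (x0 - p) (x n - p)\<close>, which upgrades the asymptotic inequality to norm
  convergence. In the limit the hypothesis becomes the variational characterisation of the nearest
  point, which identifies \<open>p\<close>.
\<close>

lemma converges_to_projection_onto_fixed_points:
  fixes T :: "'a::{real_inner, complete_space} \<Rightarrow> 'a"
  assumes C: "closed C" "convex C" "T ` C \<subseteq> C" "nonexpansive_on C T"
    and F: "fixed_point_set C T \<noteq> {}" and x0: "x0 \<in> C"
    and xC: "\<And>n. x n \<in> C" and res: "(\<lambda>n. x n - T (x n)) \<longlonglongrightarrow> 0"
    and obt: "\<And>n q. q \<in> fixed_point_set C T \<Longrightarrow> 0 \<le> inner (q - x n) (x n - x0)"
  shows "x \<longlonglongrightarrow> metric_projection (fixed_point_set C T) x0"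
proof -
  have near: "norm (x n - x0) \<le> norm (q - x0)" if "q \<in> fixed_point_set C T" for q n
    using obtuse_imp_norm_le_right[OF obt[OF that]] .
  obtain q where q: "q \<in> fixed_point_set C T"
    using F by blast
  have "Bseq x"
  proof (rule BseqI')
    show "norm (x n) \<le> norm (q - x0) + norm x0" for n
      using near[OF q, of n] norm_triangle_ineq[of "x n - x0" x0] by simp
  qed
  with approximate_fixed_points_asymptotic_obtuse[OF C F x0] xC res
  obtain p where p: "p \<in> fixed_point_set C T"
    and ev: "\<And>e. 0 < e \<Longrightarrow> \<forall>\<^sub>F n in sequentially. inner (x0 - p) (x n - p) < e"
    by blast
  have lim: "x \<longlonglongrightarrow> p"
  proof (rule tendstoI)
    fix e :: real assume "0 < e"
    then have "\<forall>\<^sub>F n in sequentially. inner (x0 - p) (x n - p) < e\<^sup>2"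
      by (intro ev) simp
    then show "\<forall>\<^sub>F n in sequentially. dist (x n) p < e"
    proof eventually_elim
      case (elim n)
      have "(norm (x n - p))\<^sup>2 = inner (x0 - p) (x n - p) - inner (p - x n) (x n - x0)"
        by (simp add: power2_norm_eq_inner inner_simps inner_commute)
      then have "(norm (x n - p))\<^sup>2 < e\<^sup>2"
        using elim obt[OF p, of n] by simp
      then show ?case
        using \<open>0 < e\<close> by (auto simp: dist_norm intro: power2_less_imp_less)
    qed
  qed
  have obt_p: "0 \<le> inner (q - p) (p - x0)" if "q \<in> fixed_point_set C T" for q
    by (rule LIMSEQ_le_const[OF tendsto_inner[OF tendsto_diff[OF tendsto_const lim]
          tendsto_diff[OF lim tendsto_const]]])
       (use obt[OF that] in blast)
  have "metric_projection (fixed_point_set C T) x0 = p"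
  proof (rule metric_projection_eqI[OF p])
    show "norm (x0 - p) \<le> norm (x0 - q)" if "q \<in> fixed_point_set C T" for q
      using obtuse_imp_norm_le_right[OF obt_p[OF that]] by (simp add: norm_minus_commute)
    fix q assume q: "q \<in> fixed_point_set C T" "norm (x0 - q) \<le> norm (x0 - p)"
    have "(norm (q - p))\<^sup>2 + (norm (p - x0))\<^sup>2 \<le> (norm (q - x0))\<^sup>2"
      using obtuse_imp_sum_sq_le[OF obt_p[OF q(1)]] .
    moreover have "(norm (q - x0))\<^sup>2 \<le> (norm (p - x0))\<^sup>2"
      using q(2) by (intro power_mono) (simp_all add: norm_minus_commute)
    ultimately have "(norm (q - p))\<^sup>2 \<le> 0"
      by linarith
    then show "q = p"
      by simp
  qed
  with lim show ?thesis
    by simp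
qed

section \<open>The hybrid scheme\<close>

lemma steps_vanish:
  fixes x :: "nat \<Rightarrow> 'a::real_inner"
  assumes "\<And>n. (norm (x (Suc n) - x n))\<^sup>2 + (norm (x n - x0))\<^sup>2 \<le> (norm (x (Suc n) - x0))\<^sup>2"
    and "\<And>n. norm (x n - x0) \<le> B"
  shows "(\<lambda>n. norm (x (Suc n) - x n)) \<longlonglongrightarrow> 0"
proof -
  define r where "r = (\<lambda>n. (norm (x n - x0))\<^sup>2)"
  have step: "(norm (x (Suc n) - x n))\<^sup>2 \<le> r (Suc n) - r n" for n
    using assms(1)[of n] by (simp add: r_def)
  have "incseq r"
  proof (rule incseq_SucI)
    show "r n \<le> r (Suc n)" for n
      using step[of n] zero_le_power2[of "norm (x (Suc n) - x n)"] by linarith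
  qed
  moreover have "r n \<le> B\<^sup>2" for n
    unfolding r_def using assms(2) by (intro power_mono) auto
  ultimately obtain L where L: "r \<longlonglongrightarrow> L"
    using incseq_convergent by blast
  have "(\<lambda>n. r (Suc n) - r n) \<longlonglongrightarrow> L - L"
    by (intro tendsto_diff L LIMSEQ_Suc)
  then have lim: "(\<lambda>n. r (Suc n) - r n) \<longlonglongrightarrow> 0"
    by simp
  have "(\<lambda>n. (norm (x (Suc n) - x n))\<^sup>2) \<longlonglongrightarrow> 0"
    by (rule tendsto_sandwich[OF _ _ tendsto_const lim]) (simp_all add: step)
  from tendsto_real_sqrt[OF this] show ?thesis
    by simp
qed

text \<open>
  The factor of \<open>b\<close> in the cut is \<open>(norm (w - v))\<^sup>2 - (norm (w - x))\<^sup>2\<close>. Expanding the norm of \<open>w - y\<close>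
  along the convex combination makes all terms quadratic in \<open>w\<close> cancel and leaves one that is
  linear in the step \<open>w - x\<close>.
\<close>

lemma cut_residual_bound:
  fixes w x v y t :: "'a::real_inner"
  assumes y: "y = (1 - b) *\<^sub>R x + b *\<^sub>R t" and "0 < b"
    and cut: "(norm (w - y))\<^sup>2 \<le> (norm (w - x))\<^sup>2 +
            b * ((norm v)\<^sup>2 - (norm x)\<^sup>2 + 2 * inner (x - v) w)"
  shows "b * (norm (x - t))\<^sup>2 \<le> (norm (x - v))\<^sup>2 + 2 * inner (w - x) (t - v)"
proof -
  have "(norm (w - y))\<^sup>2 = (norm (w - x))\<^sup>2 +
            b * ((norm v)\<^sup>2 - (norm x)\<^sup>2 + 2 * inner (x - v) w) +
     b * (b * (norm (x - t))\<^sup>2 - (norm (x - v))\<^sup>2 - 2 * inner (w - x) (t - v))"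
    unfolding y by (simp add: power2_norm_eq_inner inner_simps inner_commute algebra_simps)
  with cut have "b * (b * (norm (x - t))\<^sup>2 - (norm (x - v))\<^sup>2 - 2 * inner (w - x) (t - v)) \<le> 0"
    by linarith
  then show ?thesis
    using \<open>0 < b\<close> by (simp add: mult_le_0_iff)
qed

text \<open>
  Both sides of the premise are compared with \<open>N = norm (x - tx)\<close>. The left is at least
  \<open>\<beta> * ((1 - \<alpha>) * N)\<^sup>2\<close> and the quadratic term on the right is at most \<open>(\<alpha> * N)\<^sup>2\<close>, that is
  \<open>\<rho>\<^sup>2 * ((1 - \<alpha>) * N)\<^sup>2\<close> with \<open>\<rho> = \<alpha> / (1 - \<alpha>)\<close>. Since \<open>\<rho> < \<beta> \<le> 1\<close>, \<open>\<rho>\<^sup>2 \<le> \<rho>\<close> and the gap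
  \<open>\<beta> - \<rho>\<close> is available to absorb the right side.
\<close>

lemma residual_absorption:
  fixes x v tx tv :: "'a::real_inner"
  assumes v: "v = (1 - a) *\<^sub>R x + a *\<^sub>R tx" and t: "norm (tv - tx) \<le> norm (v - x)"
    and a: "0 \<le> a" "a \<le> \<alpha>" "\<alpha> < 1" and b: "\<alpha> / (1 - \<alpha>) < \<beta>" "\<beta> \<le> b" "b \<le> 1"
    and le: "b * (norm (x - tv))\<^sup>2 \<le> (norm (x - v))\<^sup>2 + d"
  shows "(\<beta> - \<alpha> / (1 - \<alpha>)) * (1 - \<alpha>)\<^sup>2 * (norm (x - tx))\<^sup>2 \<le> d"
proof -
  define N where "N = norm (x - tx)"
  define \<rho> where "\<rho> = \<alpha> / (1 - \<alpha>)"
  have \<rho>: "0 \<le> \<rho>" "\<rho> < \<beta>" "\<alpha> = \<rho> * (1 - \<alpha>)"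
    using a b by (simp_all add: \<rho>_def)
  then have \<rho>1: "\<rho> \<le> 1"
    using b by linarith
  have N0: "0 \<le> N"
    by (simp add: N_def)
  have "x - v = a *\<^sub>R (x - tx)"
    by (simp add: v algebra_simps)
  then have xv: "norm (x - v) = a * N"
    using a by (simp add: N_def)
  have "N \<le> norm (x - tv) + norm (tv - tx)"
    unfolding N_def using norm_triangle_ineq[of "x - tv" "tv - tx"] by simp
  then have "(1 - a) * N \<le> norm (x - tv)"
    using t xv by (simp add: norm_minus_commute algebra_simps)
  moreover have "(1 - \<alpha>) * N \<le> (1 - a) * N"
    using a N0 by (intro mult_right_mono) auto
  ultimately have "((1 - \<alpha>) * N)\<^sup>2 \<le> (norm (x - tv))\<^sup>2"
    using a N0 by (intro power_mono) auto
  then have "\<beta> * ((1 - \<alpha>) * N)\<^sup>2 \<le> b * (norm (x - tv))\<^sup>2"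
    using \<rho> b by (intro mult_mono) auto
  also have "\<dots> \<le> (a * N)\<^sup>2 + d"
    using le xv by simp
  finally have 1: "\<beta> * ((1 - \<alpha>) * N)\<^sup>2 \<le> (a * N)\<^sup>2 + d" .
  have "a * N \<le> \<rho> * ((1 - \<alpha>) * N)"
    using mult_right_mono[OF a(2) N0] \<rho>(3) by (metis mult.assoc)
  then have "(a * N)\<^sup>2 \<le> (\<rho> * ((1 - \<alpha>) * N))\<^sup>2"
    using a N0 by (intro power_mono) auto
  also have "\<dots> = \<rho>\<^sup>2 * ((1 - \<alpha>) * N)\<^sup>2"
    by (rule power_mult_distrib)
  also have "\<dots> \<le> \<rho> * ((1 - \<alpha>) * N)\<^sup>2"
    using \<rho>(1) \<rho>1 by (intro mult_right_mono) (auto simp: power2_eq_square mult_left_le)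
  finally have "(\<beta> - \<rho>) * ((1 - \<alpha>) * N)\<^sup>2 \<le> d"
    using 1 by (simp add: left_diff_distrib)
  then show ?thesis
    by (simp add: N_def \<rho>_def power_mult_distrib mult.assoc)
qed

theorem theorem6p7:
  fixes C :: "'a::{real_inner, complete_space} set"
    and T :: "'a \<Rightarrow> 'a"
    and a b :: "nat \<Rightarrow> real"
    and \<alpha> \<beta> :: real
    and x0 :: 'a
    and x v y :: "nat \<Rightarrow> 'a"
    and Cn Cstar Q :: "nat \<Rightarrow> 'a set"
  assumes "C \<noteq> {}" and "closed C" and "convex C"
    and "T ` C \<subseteq> C" and "nonexpansive_on C T"
    and "fixed_point_set C T \<noteq> {}"
    and "\<And>n. a n \<in> {0..1}" and "\<And>n. b n \<in> {0..1}"
    and "\<And>n. 0 \<le> a n \<and> a n \<le> \<alpha> \<and> \<alpha> < 1"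
    and "\<And>n. 0 \<le> a n / (1 - a n) \<and> a n / (1 - a n) \<le> \<alpha> / (1 - \<alpha>) \<and>
            \<alpha> / (1 - \<alpha>) < \<beta> \<and> \<beta> \<le> b n \<and> b n \<le> 1"
    and "x0 \<in> C" and "x 0 = x0"
    and "\<And>n. v n = (1 - a n) *\<^sub>R x n + a n *\<^sub>R T (x n)"
    and "\<And>n. y n = (1 - b n) *\<^sub>R x n + b n *\<^sub>R T (v n)"
    and "\<And>n. Cn n = {z \<in> C. (norm (z - y n))\<^sup>2 \<le> (norm (z - x n))\<^sup>2 +
            b n * ((norm (v n))\<^sup>2 - (norm (x n))\<^sup>2 + 2 * inner (x n - v n) z)}"
    and "\<And>n. Q n = {z \<in> C. inner (z - x n) (x n - x0) \<ge> 0}"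
    and "\<And>n. closed (Cstar n) \<and> convex (Cstar n) \<and>
            fixed_point_set C T \<subseteq> Cstar n \<and> Cstar n \<subseteq> Cn n"
    and "\<And>n. x (Suc n) = metric_projection (Cstar n \<inter> Q n) x0"
  shows "x \<longlonglongrightarrow> metric_projection (fixed_point_set C T) x0"
proof -
  let ?F = "fixed_point_set C T"
  note v = assms(13) and y = assms(14) and Cn = assms(15) and Q = assms(16)
    and Cstar = assms(17) and x_Suc = assms(18)
  have Q_half: "Q n = C \<inter> {z. inner (x n - x0) z \<ge> inner (x n - x0) (x n)}" for n
    by (auto simp: Q inner_simps inner_commute)
  have KC: "closed (Cstar n \<inter> Q n)" "convex (Cstar n \<inter> Q n)" for n
    using Cstar[of n] assms(2,3) unfolding Q_half
    by (auto intro!: closed_Int convex_Int closed_halfspace_ge convex_halfspace_ge)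
  \<comment> \<open>The induction also keeps \<open>Cstar n \<inter> Q n\<close> nonempty, without which the next iterate would be
    unspecified.\<close>
  have FQ: "?F \<subseteq> Q n" for n
  proof (induction n)
    case 0
    then show ?case by (auto simp: Q assms(12) fixed_point_set_def)
  next
    case (Suc n)
    then have sub: "?F \<subseteq> Cstar n \<inter> Q n"
      using Cstar[of n] by blast
    then have ne: "Cstar n \<inter> Q n \<noteq> {}"
      using assms(6) by blast
    show ?case
    proof
      fix q assume q: "q \<in> ?F"
      then have "0 \<le> inner (q - x (Suc n)) (x (Suc n) - x0)"
        unfolding x_Suc using sub by (intro metric_projection_obtuse[OF KC ne]) blast
      with q show "q \<in> Q (Suc n)"
        by (simp add: Q fixed_point_set_def)
    qed
  qed
  have x_in: "x (Suc n) \<in> Cstar n \<inter> Q n" for n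
    unfolding x_Suc using assms(6) FQ[of n] Cstar[of n]
    by (intro metric_projection_in[OF KC]) blast
  have xC: "x n \<in> C" for n
    using x_in[of "n - 1"] assms(11,12) by (cases n) (auto simp: Q)
  have vC: "v n \<in> C" for n
    unfolding v using assms(9)[of n] xC[of n] assms(3,4)
    by (intro convexD) auto
  have obt: "0 \<le> inner (q - x n) (x n - x0)" if "q \<in> ?F" for n q
    using FQ[of n] that by (auto simp: Q)
  obtain q where q: "q \<in> ?F"
    using assms(6) by blast
  then have qC: "q \<in> C" "T q = q"
    by (auto simp: fixed_point_set_def)
  define M where "M = norm (q - x0)"
  have x_x0: "norm (x n - x0) \<le> M" and x_q: "norm (x n - q) \<le> M" for n
    using obtuse_imp_norm_le_left[OF obt[OF q]] obtuse_imp_norm_le_right[OF obt[OF q]]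
    by (simp_all add: M_def norm_minus_commute[of _ q])
  define h where "h = (\<lambda>n. norm (x (Suc n) - x n))"
  have h: "h \<longlonglongrightarrow> 0"
    unfolding h_def
  proof (rule steps_vanish[OF _ x_x0])
    show "(norm (x (Suc n) - x n))\<^sup>2 + (norm (x n - x0))\<^sup>2 \<le> (norm (x (Suc n) - x0))\<^sup>2" for n
      using x_in[of n] by (intro obtuse_imp_sum_sq_le) (simp add: Q)
  qed
  define c where "c = (\<beta> - \<alpha> / (1 - \<alpha>)) * (1 - \<alpha>)\<^sup>2"
  have "0 < c"
    unfolding c_def using assms(9,10) by (intro mult_pos_pos) auto
  have res_le: "c * (norm (x n - T (x n)))\<^sup>2 \<le> 2 * (h n * (2 * M))" for n
  proof -
    have ne: "norm (T u - T u') \<le> norm (u - u')" if "u \<in> C" "u' \<in> C" for u u'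
      using assms(5) that by (simp add: nonexpansive_on_def)
    have "v n - q = (1 - a n) *\<^sub>R (x n - q) + a n *\<^sub>R (T (x n) - T q)"
      by (simp add: v qC algebra_simps)
    also have "norm \<dots> \<le> (1 - a n) * norm (x n - q) + a n * norm (T (x n) - T q)"
      using assms(7)[of n] by (intro order_trans[OF norm_triangle_ineq]) simp
    also have "\<dots> \<le> (1 - a n) * M + a n * M"
      using assms(7)[of n] x_q[of n] ne[OF xC qC(1), of n]
      by (intro add_mono mult_left_mono) auto
    finally have vq: "norm (v n - q) \<le> M"
      by (simp add: algebra_simps)
    have "norm (T (v n) - v n) \<le> norm (T (v n) - T q) + norm (v n - q)"
      using norm_triangle_ineq4[of "T (v n) - T q" "v n - q"] by (simp add: qC)
    then have Tv: "norm (T (v n) - v n) \<le> 2 * M"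
      using ne[OF vC qC(1), of n] vq by simp
    have "inner (x (Suc n) - x n) (T (v n) - v n) \<le> h n * norm (T (v n) - v n)"
      unfolding h_def by (rule norm_cauchy_schwarz)
    also have "\<dots> \<le> h n * (2 * M)"
      using Tv by (intro mult_left_mono) (simp_all add: h_def)
    finally have cs: "inner (x (Suc n) - x n) (T (v n) - v n) \<le> h n * (2 * M)" .
    have "0 \<le> \<alpha> / (1 - \<alpha>)"
      using assms(10)[of n] by linarith
    then have "0 < b n"
      using assms(10)[of n] by linarith
    moreover have "x (Suc n) \<in> Cn n"
      using x_in[of n] Cstar[of n] by blast
    ultimately have "b n * (norm (x n - T (v n)))\<^sup>2
        \<le> (norm (x n - v n))\<^sup>2 + 2 * inner (x (Suc n) - x n) (T (v n) - v n)"
      by (intro cut_residual_bound[OF y]) (simp_all add: Cn)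
    also have "\<dots> \<le> (norm (x n - v n))\<^sup>2 + 2 * (h n * (2 * M))"
      using cs by linarith
    finally show ?thesis
      unfolding c_def using assms(9,10)[of n] ne[OF vC xC]
      by (intro residual_absorption[OF v]) auto
  qed
  have "(\<lambda>n. (norm (x n - T (x n)))\<^sup>2) \<longlonglongrightarrow> 0"
  proof (rule tendsto_sandwich[OF _ _ tendsto_const])
    have "(\<lambda>n. 2 * (h n * (2 * M)) / c) \<longlonglongrightarrow> 2 * (0 * (2 * M)) / c"
      using \<open>0 < c\<close> by (intro tendsto_intros h) auto
    then show "(\<lambda>n. 2 * (h n * (2 * M)) / c) \<longlonglongrightarrow> 0"
      by simp
  qed (use res_le \<open>0 < c\<close> in \<open>auto simp: field_simps\<close>)
  from tendsto_real_sqrt[OF this] have "(\<lambda>n. x n - T (x n)) \<longlonglongrightarrow> 0"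
    by (simp add: tendsto_norm_zero_iff)
  from converges_to_projection_onto_fixed_points[OF assms(2-6,11) xC this obt]
  show ?thesis
    by blast
qed

end
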